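(* Let $(\Theta,\mathcal{T})$ be a measurable space, $\pi\in\mathcal{P}(\Theta)$, $\eta>0$, let $(\ell_s)_{s\in\mathbb{N}}$ be a sequence of $\mathcal{T}$-measurable functions $\ell_s:\Theta\to\mathbb{R}_+$, and let $\phi$ be a function on $\mathbb{R}_+$ with $\phi(1)=0$ and $\inf_{x\ge0}\phi(x)>-\infty$. Assume that $\phi$ is differentiable and strictly convex, and define $\tilde\phi$ on $\mathbb{R}$ by $\tilde\phi(x)=\phi(x)$ if $x\ge 0$ and $\tilde\phi(x)=+\infty$ otherwise. Then the convex conjugate $$\tilde\phi^*(y)=\sup_{x\in\mathbb{R}}[xy-\tilde\phi(x)]=\sup_{x\ge 0}[xy-\phi(x)]$$ is differentiable and for any $y\in\mathbb{R}$, $$\nabla\tilde\phi^*(y)=\operatorname*{argmax}_{x\ge 0}\{xy-\phi(x)\}.$$ Assume moreover that, for any $a\ge 0$, $\tilde\phi^*(\lambda-a)-\lambda\to\infty$ when $\lambda\to\infty$. Then, for each $t\ge1$, $$\lambda_t=\operatorname*{argmin}_{\lambda\in\mathbb{R}}\left\{\int\tilde\phi^*\left(\lambda-\eta\sum_{s=1}^{t-1}\ell_s(\theta)\right)\pi(d\theta)-\lambda\right\}$$ exists, and $$\rho^t(d\theta)=\nabla\tilde\phi^*\left(\lambda_t-\eta\sum_{s=1}^{t-1}\ell_s(\theta)\right)\pi(d\theta)$$ minimizes $$\rho\mapsto\sum_{s=1}^{t-1}\mathbb{E}_{\theta\sim\rho}[\ell_s(\theta)]+\frac{D_\phi(\rho\|\pi)}{\eta}$$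 over $\rho\in\mathcal{P}(\Theta)$.
   Context: $\mathcal{P}(\Theta)$ is the set of all probability distributions on $(\Theta,\mathcal{T})$. The $\phi$-divergence is $D_\phi(\rho\|\pi)=\mathbb{E}_{\theta\sim\pi}\left[\phi\left(\frac{d\rho}{d\pi}(\theta)\right)\right]$ if $\rho\ll\pi$, and $+\infty$ otherwise. $\nabla\tilde\phi^*$ denotes the derivative of $\tilde\phi^*$.
   Formalization: The formal statement additionally assumes that the conjugate φ̃*(y) is finite for every real y; without this the claim fails, e.g. for φ(x)=e^{-x}-e^{-1}, where φ̃*(y)=+∞ for y>0 and no argmax exists for y≥0. *)

theory Defs
  imports "HOL-Probability.Probability"
begin

definition strictly_convex_on :: "real set \<Rightarrow> (real \<Rightarrow> real) \<Rightarrow> bool" where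
  "strictly_convex_on S f \<longleftrightarrow> convex S \<and>
     (\<forall>x\<in>S. \<forall>y\<in>S. x \<noteq> y \<longrightarrow>
        (\<forall>u. 0 < u \<and> u < 1 \<longrightarrow> f ((1 - u) * x + u * y) < (1 - u) * f x + u * f y))"

text \<open>
  A function \<open>\<phi>\<close> on the nonnegative reals is represented by a total function of which only the
  values on \<open>{0..}\<close> matter.
\<close>

definition extend_phi :: "(real \<Rightarrow> real) \<Rightarrow> real \<Rightarrow> ereal" where
  "extend_phi \<phi> x = (if 0 \<le> x then ereal (\<phi> x) else \<infinity>)"

definition convex_conjugate :: "(real \<Rightarrow> ereal) \<Rightarrow> real \<Rightarrow> ereal" where
  "convex_conjugate f y = (SUP x. ereal (x * y) - f x)"

text \<open>The real-valued version is meaningful only where the conjugate is finite.\<close>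

definition phi_conj :: "(real \<Rightarrow> real) \<Rightarrow> real \<Rightarrow> real" where
  "phi_conj \<phi> y = real_of_ereal (convex_conjugate (extend_phi \<phi>) y)"

text \<open>
  Expectation with values in the extended reals, as the positive part minus the negative part.
  It is the expectation in the usual sense as soon as one of the two parts is finite; this is the
  case, with respect to a probability measure, for every function that is bounded below.
\<close>

definition ext_expectation :: "'a measure \<Rightarrow> ('a \<Rightarrow> real) \<Rightarrow> ereal" where
  "ext_expectation M f =
     enn2ereal (\<integral>\<^sup>+ x. ennreal (f x) \<partial>M) - enn2ereal (\<integral>\<^sup>+ x. ennreal (- f x) \<partial>M)"

text \<open>\<open>absolutely_continuous \<pi> \<rho>\<close> says that \<open>\<rho>\<close> is absolutely continuous with respect to \<open>\<pi>\<close>.\<close>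

definition phi_divergence :: "(real \<Rightarrow> real) \<Rightarrow> 'a measure \<Rightarrow> 'a measure \<Rightarrow> ereal" where
  "phi_divergence \<phi> \<rho> \<pi> =
     (if absolutely_continuous \<pi> \<rho>
      then ext_expectation \<pi> (\<lambda>\<theta>. \<phi> (enn2real (RN_deriv \<pi> \<rho> \<theta>)))
      else \<infinity>)"

end

(* Fenchel duality. Finiteness of the conjugate makes x y - phi x coercive in x, so the maximum is
   attained, at one point g y by strict convexity; g is a continuous selection of subgradients of
   the conjugate, hence its derivative. With K = eta * (sum of the losses), the dual function
   l |-> (integral of phi^*(l - K)) - l is coercive: phi^* is bounded below, and it is superlinear
   because phi is finite everywhere. At its minimizer the density g(l - K) has mass 1. Integrating phi r + phi^*(l - K) >= r (l - K) bounds the primal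
   functional below by minus the dual one, with equality for r = g(l - K). *)

theory Submission
  imports Defs
begin

section \<open>Preliminaries: subgradients, coercivity, extended expectations, strict
  convexity\<close>

text \<open>The inequalities based at \<open>x\<close> and at \<open>y\<close> give \<open>0 \<le> f
  y - f x - g x * (y - x) \<le> (g y - g x) * (y - x)\<close>, so the difference quotient is within
  \<open>\<bar>g y - g x\<bar>\<close> of \<open>g x\<close>. Both the conjugate and the dual
  function are differentiated this way.\<close>

lemma subgradient_imp_DERIV:
  fixes f g :: "real \<Rightarrow> real"
  assumes sub: "\<And>x y. f x + g x * (y - x) \<le> f y"
    and cont: "isCont g x"
  shows "(f has_real_derivative g x) (at x)"
  unfolding has_field_derivative_iff
proof (rule LIM_I)
  fix e :: real
  assume "0 < e"
  with cont obtain d where d: "d > 0" "\<And>y. norm (y - x) < d \<Longrightarrow> norm (g y - g x) < e"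
    unfolding isCont_iff LIM_eq
    by (metis (no_types, lifting) add.commute diff_add_cancel diff_zero norm_zero right_minus_eq)
  have "norm ((f y - f x) / (y - x) - g x) < e" if y: "y \<noteq> x" "norm (y - x) < d" for y
  proof -
    have lo: "g x * (y - x) \<le> f y - f x" using sub[of x y] by simp
    have hi: "f y - f x \<le> g y * (y - x)" using sub[of y x] by (simp add: algebra_simps)
    have *: "(f y - f x) / (y - x) - g x = (f y - f x - g x * (y - x)) / (y - x)"
      using y by (simp add: field_simps)
    have "norm ((f y - f x) / (y - x) - g x) = (f y - f x - g x * (y - x)) / \<bar>y - x\<bar>"
      unfolding * using lo by simp
    also have "\<dots> \<le> ((g y - g x) * (y - x)) / \<bar>y - x\<bar>"
      using hi by (intro divide_right_mono) (auto simp: algebra_simps)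
    also have "\<dots> \<le> (\<bar>g y - g x\<bar> * \<bar>y - x\<bar>) / \<bar>y - x\<bar>"
      by (intro divide_right_mono) (auto simp flip: abs_mult)
    also have "\<dots> = \<bar>g y - g x\<bar>" using y by simp
    also have "\<dots> < e" using d(2)[OF y(2)] by simp
    finally show ?thesis .
  qed
  then show "\<exists>s>0. \<forall>y. y \<noteq> x \<and> norm (y - x) < s \<longrightarrow> norm ((f y - f x) / (y - x) - g x) < e"
    using d(1) by blast
qed

lemma continuous_coercive_attains_inf:
  fixes F :: "real \<Rightarrow> real"
  assumes cont: "continuous_on UNIV F"
    and top: "filterlim F at_top at_top" and bot: "filterlim F at_top at_bot"
  shows "\<exists>l. \<forall>l'. F l \<le> F l'"
proof -
  obtain b where b: "\<And>x. x \<ge> b \<Longrightarrow> F x \<ge> F 0"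
    using top unfolding filterlim_at_top eventually_at_top_linorder by blast
  obtain a where a: "\<And>x. x \<le> a \<Longrightarrow> F x \<ge> F 0"
    using bot unfolding filterlim_at_top eventually_at_bot_linorder by blast
  let ?S = "{min a 0..max b 0}"
  obtain l where l: "l \<in> ?S" "\<And>x. x \<in> ?S \<Longrightarrow> F l \<le> F x"
    using continuous_attains_inf[of ?S F] continuous_on_subset[OF cont, of ?S]
    by (metis atLeastAtMost_iff compact_Icc empty_iff max.cobounded2 min.cobounded2 subset_UNIV)
  have "F l \<le> F x" for x
  proof (cases "x \<in> ?S")
    case False
    then have "x \<le> a \<or> b \<le> x" by (auto simp: not_le)
    then have "F 0 \<le> F x" using a[of x] b[of x] by blast
    moreover have "F l \<le> F 0" by (intro l(2)) auto
    ultimately show ?thesis by simp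
  qed (use l in auto)
  then show ?thesis by blast
qed

text \<open>A lower bound on a finite measure makes the negative part integrable, so
  \<open>\<infinity> - \<infinity>\<close> cannot occur and only the positive part decides
  finiteness.\<close>

lemma (in finite_measure) ext_expectation_bounded_below:
  assumes f [measurable]: "f \<in> borel_measurable M"
    and c: "\<And>x. x \<in> space M \<Longrightarrow> c \<le> f x"
  shows "ext_expectation M f = (if integrable M f then ereal (\<integral>x. f x \<partial>M) else \<infinity>)"
proof -
  have "(\<integral>\<^sup>+ x. ennreal (- f x) \<partial>M) \<le> (\<integral>\<^sup>+ x. ennreal \<bar>c\<bar> \<partial>M)"
    by (intro nn_integral_mono) (use c in \<open>force intro: ennreal_leI\<close>)
  also have "\<dots> < \<infinity>"
    by (simp add: less_top[symmetric] ennreal_mult_eq_top_iff)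
  finally have neg: "(\<integral>\<^sup>+ x. ennreal (- f x) \<partial>M) < \<infinity>" .
  show ?thesis
  proof (cases "(\<integral>\<^sup>+ x. ennreal (f x) \<partial>M) = \<infinity>")
    case True
    then have "\<not> integrable M f" by (simp add: real_integrable_def)
    moreover have "\<bar>enn2ereal (\<integral>\<^sup>+ x. ennreal (- f x) \<partial>M)\<bar> \<noteq> \<infinity>"
      using neg by (metis abs_ereal_ge0 enn2ereal_eq_top_iff enn2ereal_nonneg infinity_ennreal_def less_irrefl)
    ultimately show ?thesis
      using True by (simp add: ext_expectation_def)
  next
    case False
    then have int: "integrable M f" using neg by (simp add: real_integrable_def)
    obtain p where p: "0 \<le> p" "(\<integral>\<^sup>+ x. ennreal (f x) \<partial>M) = ennreal p"
      using False by (cases "\<integral>\<^sup>+ x. ennreal (f x) \<partial>M") auto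
    obtain q where q: "0 \<le> q" "(\<integral>\<^sup>+ x. ennreal (- f x) \<partial>M) = ennreal q"
      using neg by (cases "\<integral>\<^sup>+ x. ennreal (- f x) \<partial>M") auto
    have "(\<integral>x. f x \<partial>M) = p - q"
      using real_lebesgue_integral_def[OF int] p q by simp
    then show ?thesis
      using int p q by (simp add: ext_expectation_def enn2ereal_ennreal)
  qed
qed

text \<open>Strict convexity with denominators cleared: the weights are the distances of
  \<open>z\<close> to the endpoints.\<close>

lemma strictly_convex_onD:
  assumes "strictly_convex_on S f" "x \<in> S" "y \<in> S" "x < z" "z < y"
  shows "(y - x) * f z < (y - z) * f x + (z - x) * f y"
proof -
  define u where "u = (z - x) / (y - x)"
  have u: "0 < u" "u < 1" using assms by (auto simp: u_def field_simps)
  have *: "u * (y - x) = z - x" using assms by (simp add: u_def)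
  have z: "(1 - u) * x + u * y = z" using * by (simp add: algebra_simps)
  have "f z < (1 - u) * f x + u * f y"
    using assms u unfolding strictly_convex_on_def by (metis less_irrefl less_trans z)
  then have "(y - x) * f z < (y - x) * ((1 - u) * f x + u * f y)"
    using assms by (intro mult_strict_left_mono) auto
  also have "\<dots> = ((y - x) - u * (y - x)) * f x + (u * (y - x)) * f y"
    by (simp add: algebra_simps)
  finally show ?thesis unfolding * by (simp add: algebra_simps)
qed

text \<open>A negative \<open>x\<close> contributes \<open>-\<infinity>\<close> to the
  supremum.\<close>

lemma convex_conjugate_extend_phi:
  "convex_conjugate (extend_phi \<phi>) y = (SUP x\<in>{0..}. ereal (x * y - \<phi> x))"
  unfolding convex_conjugate_def
proof (rule antisym)
  show "(SUP x. ereal (x * y) - extend_phi \<phi> x) \<le> (SUP x\<in>{0..}. ereal (x * y - \<phi> x))"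
  proof (rule SUP_least)
    fix x
    show "ereal (x * y) - extend_phi \<phi> x \<le> (SUP x\<in>{0..}. ereal (x * y - \<phi> x))"
      by (cases "0 \<le> x") (auto simp: extend_phi_def intro: SUP_upper2)
  qed
  show "(SUP x\<in>{0..}. ereal (x * y - \<phi> x)) \<le> (SUP x. ereal (x * y) - extend_phi \<phi> x)"
  proof (rule SUP_least)
    fix x :: real
    assume "x \<in> {0..}"
    then show "ereal (x * y - \<phi> x) \<le> (SUP x. ereal (x * y) - extend_phi \<phi> x)"
      by (intro SUP_upper2[of x]) (auto simp: extend_phi_def)
  qed
qed

section \<open>The conjugate of a strictly convex function\<close>

text \<open>\<open>conj_finite\<close> says that the conjugate is a real function on the whole line,
  which its differentiability there presupposes. The derivative of \<open>\<phi>\<close> is taken in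
  the interior; at the endpoint 0 continuity is asked.\<close>

locale divergence_function =
  fixes \<phi> :: "real \<Rightarrow> real"
  assumes cont: "continuous_on {0..} \<phi>"
    and diff: "\<And>x. x > 0 \<Longrightarrow> \<phi> differentiable (at x)"
    and strict: "strictly_convex_on {0..} \<phi>"
    and conj_finite: "\<And>y. convex_conjugate (extend_phi \<phi>) y < \<infinity>"
begin

lemma conj_eq: "convex_conjugate (extend_phi \<phi>) y = ereal (phi_conj \<phi> y)"
proof -
  have "ereal (0 * y - \<phi> 0) \<le> convex_conjugate (extend_phi \<phi>) y"
    unfolding convex_conjugate_extend_phi by (rule SUP_upper) simp
  with conj_finite[of y] show ?thesis
    unfolding phi_conj_def by (cases "convex_conjugate (extend_phi \<phi>) y") auto
qed

lemma fenchel: "0 \<le> x \<Longrightarrow> x * y - \<phi> x \<le> phi_conj \<phi> y"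
  using SUP_upper[of x "{0..}" "\<lambda>x. ereal (x * y - \<phi> x)"]
  unfolding convex_conjugate_extend_phi[symmetric] conj_eq by simp

text \<open>Fenchel's inequality at \<open>y + 1\<close> bounds \<open>x * y - \<phi> x\<close> by a constant minus \<open>x\<close>, so the
  supremum can be taken over a compact interval.\<close>

lemma conj_attained: "\<exists>x\<ge>0. x * y - \<phi> x = phi_conj \<phi> y"
proof -
  \<comment> \<open>Past \<open>B\<close> the bound obtained from slope \<open>y + 1\<close> drops
    below \<open>- \<phi> 0\<close>, the value at \<open>x = 0\<close>.\<close>
  define B where "B = max 0 (phi_conj \<phi> (y + 1) + \<phi> 0)"
  have "continuous_on {0..B} (\<lambda>x. x * y - \<phi> x)"
    by (intro continuous_intros continuous_on_subset[OF cont]) auto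
  then obtain x where x: "x \<in> {0..B}" "\<And>z. z \<in> {0..B} \<Longrightarrow> z * y - \<phi> z \<le> x * y - \<phi> x"
    using continuous_attains_sup[of "{0..B}" "\<lambda>x. x * y - \<phi> x"] by (auto simp: B_def)
  have "z * y - \<phi> z \<le> x * y - \<phi> x" if "0 \<le> z" for z
  proof (cases "z \<le> B")
    case False
    then have "z * y - \<phi> z \<le> 0 * y - \<phi> 0"
      using fenchel[OF that, of "y + 1"] by (simp add: B_def algebra_simps)
    also have "\<dots> \<le> x * y - \<phi> x" by (intro x) (auto simp: B_def)
    finally show ?thesis .
  qed (use x that in auto)
  then have "convex_conjugate (extend_phi \<phi>) y \<le> ereal (x * y - \<phi> x)"
    unfolding convex_conjugate_extend_phi by (intro SUP_least) auto
  then have "phi_conj \<phi> y \<le> x * y - \<phi> x" by (simp add: conj_eq)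
  with fenchel[of x y] x show ?thesis by (intro exI[of _ x]) auto
qed

text \<open>The choice is harmless: \<open>maximizer_unique\<close> shows that there is only one
  candidate, and \<open>deriv_conj\<close> identifies it with the gradient of the conjugate.\<close>

definition maximizer :: "real \<Rightarrow> real" where
  "maximizer y = (SOME x. 0 \<le> x \<and> x * y - \<phi> x = phi_conj \<phi> y)"

lemma maximizer_nonneg [simp]: "0 \<le> maximizer y"
  and maximizer_attains: "maximizer y * y - \<phi> (maximizer y) = phi_conj \<phi> y"
  using someI_ex[OF conj_attained[of y]] unfolding maximizer_def by blast+

text \<open>Strict quasiconcavity of \<open>x * y - \<phi> x\<close>: the linear term is exact on
  the convex combination \<open>b\<close>, so strict convexity of \<open>\<phi>\<close> alone gives
  the gap.\<close>

lemma concave_between: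
  assumes "0 \<le> a" "a < b" "b < c"
  shows "min (a * y - \<phi> a) (c * y - \<phi> c) < b * y - \<phi> b"
proof -
  define m where "m = min (a * y - \<phi> a) (c * y - \<phi> c)"
  have s: "(c - a) * \<phi> b < (c - b) * \<phi> a + (b - a) * \<phi> c"
    using strictly_convex_onD[OF strict, of a c b] assms by simp
  have "(c - b) * m \<le> (c - b) * (a * y - \<phi> a)" "(b - a) * m \<le> (b - a) * (c * y - \<phi> c)"
    using assms by (auto intro!: mult_left_mono simp: m_def)
  then have "(c - a) * m \<le> (c - b) * (a * y - \<phi> a) + (b - a) * (c * y - \<phi> c)"
    by (simp add: algebra_simps)
  also have "\<dots> = (c - a) * (b * y) - ((c - b) * \<phi> a + (b - a) * \<phi> c)"
    by (simp add: algebra_simps)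
  also have "\<dots> < (c - a) * (b * y - \<phi> b)"
    using s by (simp add: algebra_simps)
  finally show ?thesis using assms by (simp add: m_def)
qed

text \<open>The midpoint of two distinct maximizers would exceed the supremum.\<close>

lemma maximizer_unique:
  assumes "0 \<le> x" "x * y - \<phi> x = phi_conj \<phi> y"
  shows "x = maximizer y"
proof -
  have False if ab: "0 \<le> a" "a < b" "a * y - \<phi> a = phi_conj \<phi> y" "b * y - \<phi> b = phi_conj \<phi> y"
    for a b
    using concave_between[of a "(a + b) / 2" b y] fenchel[of "(a + b) / 2" y] ab by simp
  from this[of x "maximizer y"] this[of "maximizer y" x] show ?thesis
    using assms maximizer_attains[of y] by (meson linorder_neqE_linordered_idom maximizer_nonneg)
qed

lemma is_arg_max_iff_maximizer:
  "is_arg_max (\<lambda>x. x * y - \<phi> x) (\<lambda>x. 0 \<le> x) z \<longleftrightarrow> z = maximizer y"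
proof
  assume z: "is_arg_max (\<lambda>x. x * y - \<phi> x) (\<lambda>x. 0 \<le> x) z"
  then have "z * y - \<phi> z = phi_conj \<phi> y"
    using maximizer_attains[of y] fenchel[of z y] maximizer_nonneg[of y]
    unfolding is_arg_max_def by (metis order_le_less)
  then show "z = maximizer y" using z by (intro maximizer_unique) (auto simp: is_arg_max_def)
next
  assume "z = maximizer y"
  then show "is_arg_max (\<lambda>x. x * y - \<phi> x) (\<lambda>x. 0 \<le> x) z"
    using maximizer_attains[of y] fenchel[of _ y] by (fastforce simp: is_arg_max_def not_less)
qed

text \<open>The maximizer for \<open>y\<close> is a competitor in the supremum for
  \<open>y'\<close>.\<close>

lemma conj_subgradient: "phi_conj \<phi> y + maximizer y * (y' - y) \<le> phi_conj \<phi> y'"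
  using fenchel[OF maximizer_nonneg, of y y'] maximizer_attains[of y] by (simp add: algebra_simps)

text \<open>Adding the subgradient inequalities at \<open>y\<close> and \<open>y'\<close> cancels
  the conjugate values.\<close>

lemma mono_maximizer: "mono maximizer"
proof (rule monoI)
  fix y y' :: real
  assume "y \<le> y'"
  have "0 \<le> (maximizer y' - maximizer y) * (y' - y)"
    using conj_subgradient[of y y'] conj_subgradient[of y' y] by (simp add: algebra_simps)
  then show "maximizer y \<le> maximizer y'"
    using \<open>y \<le> y'\<close> by (cases "y = y'") (auto simp: zero_le_mult_iff)
qed

lemma mono_conj: "mono (phi_conj \<phi>)"
proof (rule monoI)
  fix y y' :: real
  assume "y \<le> y'"
  then have "0 \<le> maximizer y * (y' - y)" by simp
  with conj_subgradient[of y y'] show "phi_conj \<phi> y \<le> phi_conj \<phi> y'" by linarith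
qed

text \<open>If \<open>a\<close> beats \<open>b\<close> for the slope \<open>z\<close>, concavity keeps the maximizer for \<open>z\<close> on the side of
  \<open>b\<close> on which \<open>a\<close> lies; and a strict inequality at \<open>y\<close> persists for slopes \<open>z\<close> near \<open>y\<close>.\<close>

lemma maximizer_separated:
  assumes "0 \<le> b" "b \<noteq> maximizer y"
  shows "eventually (\<lambda>z. if maximizer y < b then maximizer z < b else b < maximizer z) (nhds y)"
proof -
  let ?a = "maximizer y"
  have "b * y - \<phi> b < ?a * y - \<phi> ?a"
    using fenchel[OF assms(1), of y] maximizer_unique[OF assms(1), of y] assms(2) maximizer_attains[of y]
    by (metis order_le_less)
  moreover have "((\<lambda>z. (?a * z - \<phi> ?a) - (b * z - \<phi> b)) \<longlongrightarrow> (?a * y - \<phi> ?a) - (b * y - \<phi> b)) (nhds y)"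
    by (intro tendsto_intros filterlim_ident)
  ultimately have "eventually (\<lambda>z. 0 < (?a * z - \<phi> ?a) - (b * z - \<phi> b)) (nhds y)"
    by (intro order_tendstoD(1)) auto
  then show ?thesis
  proof eventually_elim
    case (elim z)
    have max: "x * z - \<phi> x \<le> maximizer z * z - \<phi> (maximizer z)" if "0 \<le> x" for x
      using fenchel[OF that, of z] maximizer_attains[of z] by simp
    have a: "?a * z - \<phi> ?a \<le> maximizer z * z - \<phi> (maximizer z)" by (rule max) simp
    have ne: "maximizer z \<noteq> b" using elim a by auto
    show ?case
    proof (rule ccontr)
      assume "\<not> ?thesis"
      then consider "?a < b" "b < maximizer z" | "b < ?a" "maximizer z < b"
        using ne assms(2) by (auto split: if_splits)
      then show False
        using elim a concave_between[of ?a b "maximizer z" z] concave_between[of "maximizer z" b ?a z]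
        by cases auto
    qed
  qed
qed

text \<open>In the order topology it suffices to separate \<open>maximizer y\<close> from each level
  \<open>b\<close>. Levels \<open>b \<ge> 0\<close> are covered by
  \<open>maximizer_separated\<close>; negative ones lie below every maximizer.\<close>

lemma isCont_maximizer: "isCont maximizer y"
  unfolding isCont_def
proof (rule order_tendstoI)
  fix b
  assume b: "b < maximizer y"
  show "eventually (\<lambda>z. b < maximizer z) (at y)"
  proof (cases "0 \<le> b")
    case True
    with maximizer_separated[of b y] b have "eventually (\<lambda>z. b < maximizer z) (nhds y)"
      by (auto elim: eventually_mono)
    then show ?thesis by (auto simp: eventually_at_filter elim: eventually_mono)
  next
    case False
    then show ?thesis by (intro always_eventually allI) (smt (verit) maximizer_nonneg)
  qed
next
  fix b
  assume b: "maximizer y < b"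
  then have "0 \<le> b" using maximizer_nonneg[of y] by linarith
  with maximizer_separated[of b y] b have "eventually (\<lambda>z. maximizer z < b) (nhds y)"
    by (auto elim: eventually_mono)
  then show "eventually (\<lambda>z. maximizer z < b) (at y)"
    by (auto simp: eventually_at_filter elim: eventually_mono)
qed

lemma DERIV_conj: "(phi_conj \<phi> has_real_derivative maximizer y) (at y)"
  by (rule subgradient_imp_DERIV[OF conj_subgradient isCont_maximizer])

lemma deriv_conj: "deriv (phi_conj \<phi>) = maximizer"
  using DERIV_conj DERIV_imp_deriv by blast

text \<open>At a positive maximizer the derivative of \<open>\<phi>\<close> equals the slope, so one
  point cannot serve two slopes. At 0 it can, because the maximum there is on the boundary.\<close>

lemma maximizer_strict_mono:
  assumes "y < y'" "0 < maximizer y"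
  shows "maximizer y < maximizer y'"
proof (rule ccontr)
  assume "\<not> ?thesis"
  then have eq: "maximizer y' = maximizer y"
    using monoD[OF mono_maximizer, of y y'] assms by auto
  let ?x = "maximizer y"
  obtain D where D: "(\<phi> has_real_derivative D) (at ?x)"
    using diff[OF assms(2)] real_differentiable_def by blast
  have "D = z" if z: "maximizer z = ?x" for z
  proof -
    have "((\<lambda>x. x * z - \<phi> x) has_real_derivative (z - D)) (at ?x)"
      using D by (auto intro!: derivative_eq_intros)
    \<comment> \<open>Radius \<open>?x\<close> keeps the neighbourhood inside the positive reals,
      where Fenchel's inequality applies.\<close>
    moreover have "\<forall>x. \<bar>?x - x\<bar> < ?x \<longrightarrow> x * z - \<phi> x \<le> ?x * z - \<phi> ?x"
      using fenchel[of _ z] maximizer_attains[of z] z by auto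
    ultimately have "z - D = 0" using assms(2) by (intro DERIV_local_max)
    then show ?thesis by simp
  qed
  from this[of y] this[of y'] eq assms show False by simp
qed

lemma borel_measurable_maximizer [measurable]: "maximizer \<in> borel_measurable borel"
  by (rule borel_measurable_mono[OF mono_maximizer])

lemma borel_measurable_conj [measurable]: "phi_conj \<phi> \<in> borel_measurable borel"
  by (rule borel_measurable_mono[OF mono_conj])

text \<open>Nothing is known of \<open>\<phi>\<close> on negative reals;
  \<open>\<phi> (max 0 x)\<close> is continuous on the whole line and agrees with it along
  \<open>f\<close>.\<close>

lemma borel_measurable_phi_comp:
  assumes [measurable]: "f \<in> borel_measurable N" and nn: "\<And>x. 0 \<le> f x"
  shows "(\<lambda>x. \<phi> (f x)) \<in> borel_measurable N"
proof -
  have "continuous_on UNIV (\<lambda>x. \<phi> (max 0 x))"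
    by (rule continuous_on_compose2[OF cont]) (auto intro: continuous_intros)
  then have [measurable]: "(\<lambda>x. \<phi> (max 0 x)) \<in> borel_measurable borel"
    by (rule borel_measurable_continuous_onI)
  have "(\<lambda>x. \<phi> (max 0 (f x))) \<in> borel_measurable N" by measurable
  then show ?thesis using nn by (simp add: max_def)
qed

lemma phi_lower_bound: "0 \<le> x \<Longrightarrow> - phi_conj \<phi> 0 \<le> \<phi> x"
  using fenchel[of x 0] by simp

lemma conj_lower_bound: "- \<phi> 0 \<le> phi_conj \<phi> y"
  using fenchel[of 0 y] by simp

end

section \<open>The dual problem\<close>

locale divergence_penalty = divergence_function \<phi> + prob_space \<pi>
  for \<phi> :: "real \<Rightarrow> real" and \<pi> :: "'a measure" +
  fixes K :: "'a \<Rightarrow> real"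
  assumes K_measurable [measurable]: "K \<in> borel_measurable \<pi>"
    and K_nonneg: "\<And>\<theta>. \<theta> \<in> space \<pi> \<Longrightarrow> 0 \<le> K \<theta>"
begin

lemma conj_le: "\<theta> \<in> space \<pi> \<Longrightarrow> phi_conj \<phi> (l - K \<theta>) \<le> phi_conj \<phi> l"
  using K_nonneg[of \<theta>] by (intro monoD[OF mono_conj]) simp

lemma maximizer_le: "\<theta> \<in> space \<pi> \<Longrightarrow> maximizer (l - K \<theta>) \<le> maximizer l"
  using K_nonneg[of \<theta>] by (intro monoD[OF mono_maximizer]) simp

lemma integrable_conj: "integrable \<pi> (\<lambda>\<theta>. phi_conj \<phi> (l - K \<theta>))"
proof (rule integrable_const_bound[where B = "max \<bar>\<phi> 0\<bar> \<bar>phi_conj \<phi> l\<bar>"])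
  show "AE \<theta> in \<pi>. norm (phi_conj \<phi> (l - K \<theta>)) \<le> max \<bar>\<phi> 0\<bar> \<bar>phi_conj \<phi> l\<bar>"
  proof (rule AE_I2)
    fix \<theta>
    assume "\<theta> \<in> space \<pi>"
    with conj_le[of \<theta> l] conj_lower_bound[of "l - K \<theta>"]
    show "norm (phi_conj \<phi> (l - K \<theta>)) \<le> max \<bar>\<phi> 0\<bar> \<bar>phi_conj \<phi> l\<bar>" by auto
  qed
qed measurable

lemma integrable_maximizer: "integrable \<pi> (\<lambda>\<theta>. maximizer (l - K \<theta>))"
  by (rule integrable_const_bound[where B = "maximizer l"]) (auto intro!: AE_I2 maximizer_le)

definition dual :: "real \<Rightarrow> real" where
  "dual l = (\<integral>\<theta>. phi_conj \<phi> (l - K \<theta>) \<partial>\<pi>) - l"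

text \<open>The derivative of \<open>dual\<close>, which is the excess mass of the density
  \<open>maximizer (l - K \<theta>)\<close>; stationarity is therefore normalization.\<close>

definition ddual :: "real \<Rightarrow> real" where
  "ddual l = (\<integral>\<theta>. maximizer (l - K \<theta>) \<partial>\<pi>) - 1"

text \<open>Integrating the pointwise subgradient inequality replaces differentiation under the
  integral sign.\<close>

lemma dual_subgradient: "dual l + ddual l * (l' - l) \<le> dual l'"
proof -
  have "(\<integral>\<theta>. phi_conj \<phi> (l - K \<theta>) \<partial>\<pi>) + (\<integral>\<theta>. maximizer (l - K \<theta>) \<partial>\<pi>) * (l' - l)
      = (\<integral>\<theta>. phi_conj \<phi> (l - K \<theta>) + maximizer (l - K \<theta>) * (l' - l) \<partial>\<pi>)"
    using integrable_conj integrable_maximizer by simp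
  also have "\<dots> \<le> (\<integral>\<theta>. phi_conj \<phi> (l' - K \<theta>) \<partial>\<pi>)"
  proof (rule integral_mono)
    show "phi_conj \<phi> (l - K \<theta>) + maximizer (l - K \<theta>) * (l' - l) \<le> phi_conj \<phi> (l' - K \<theta>)" for \<theta>
      using conj_subgradient[of "l - K \<theta>" "l' - K \<theta>"] by simp
  qed (use integrable_conj integrable_maximizer in auto)
  finally show ?thesis by (simp add: dual_def ddual_def algebra_simps)
qed

text \<open>Dominated convergence. Since \<open>maximizer\<close> is monotone and \<open>K\<close>
  nonnegative, the constant \<open>maximizer (l + 1)\<close> dominates as long as the argument stays
  in a window of radius 1 around \<open>l\<close>.\<close>

lemma isCont_ddual: "isCont ddual l"
proof -
  have "((\<lambda>l. \<integral>\<theta>. maximizer (l - K \<theta>) \<partial>\<pi>) \<longlongrightarrow> (\<integral>\<theta>. maximizer (l - K \<theta>) \<partial>\<pi>)) (at l within {l-1<..<l+1})"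
    unfolding tendsto_at_iff_sequentially comp_def
  proof (intro allI impI)
    fix X :: "nat \<Rightarrow> real"
    assume X: "\<forall>i. X i \<in> {l - 1<..<l + 1} - {l}" "X \<longlonglongrightarrow> l"
    show "(\<lambda>i. \<integral>\<theta>. maximizer (X i - K \<theta>) \<partial>\<pi>) \<longlonglongrightarrow> (\<integral>\<theta>. maximizer (l - K \<theta>) \<partial>\<pi>)"
    proof (rule integral_dominated_convergence[where w = "\<lambda>_. maximizer (l + 1)"])
      show "AE \<theta> in \<pi>. (\<lambda>i. maximizer (X i - K \<theta>)) \<longlonglongrightarrow> maximizer (l - K \<theta>)"
        by (intro AE_I2 isCont_tendsto_compose[OF isCont_maximizer] tendsto_intros X)
      show "AE \<theta> in \<pi>. norm (maximizer (X i - K \<theta>)) \<le> maximizer (l + 1)" for i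
      proof (rule AE_I2)
        fix \<theta>
        assume "\<theta> \<in> space \<pi>"
        then have "maximizer (X i - K \<theta>) \<le> maximizer (X i)" by (rule maximizer_le)
        also have "\<dots> \<le> maximizer (l + 1)"
          using X(1)[rule_format, of i] by (intro monoD[OF mono_maximizer]) simp
        finally show "norm (maximizer (X i - K \<theta>)) \<le> maximizer (l + 1)" by simp
      qed
    qed auto
  qed
  then have "((\<lambda>l. \<integral>\<theta>. maximizer (l - K \<theta>) \<partial>\<pi>) \<longlongrightarrow> (\<integral>\<theta>. maximizer (l - K \<theta>) \<partial>\<pi>)) (at l)"
    by (simp add: at_within_open[of l "{l-1<..<l+1}"])
  then show ?thesis
    unfolding isCont_def ddual_def by (intro tendsto_intros)
qed

lemma DERIV_dual: "(dual has_real_derivative ddual l) (at l)"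
  by (rule subgradient_imp_DERIV[OF dual_subgradient isCont_ddual])

text \<open>On an event \<open>{K \<le> N}\<close> of probability \<open>p > 0\<close>, Fenchel's inequality at \<open>x = 2 / p\<close>
  makes the integral grow at least like \<open>2 * l\<close>.\<close>

lemma dual_at_top: "filterlim dual at_top at_top"
proof -
  \<comment> \<open>If all these events were null, \<open>K\<close> would exceed every natural
    number almost everywhere.\<close>
  obtain N :: nat where N: "0 < prob {\<theta> \<in> space \<pi>. K \<theta> \<le> real N}"
  proof (rule ccontr)
    assume "\<not> thesis"
    then have "prob {\<theta> \<in> space \<pi>. K \<theta> \<le> real N} = 0" for N
      using that by (metis measure_nonneg order_le_less)
    then have "AE \<theta> in \<pi>. \<not> K \<theta> \<le> real N" for N
      by (subst AE_iff_measurable[OF _ refl]) (auto simp: emeasure_eq_measure)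
    then have "AE \<theta> in \<pi>. \<forall>N. \<not> K \<theta> \<le> real N" by (simp add: AE_all_countable)
    then have "AE \<theta> in \<pi>. False"
      by (rule eventually_mono) (meson real_arch_simple)
    then show False by simp
  qed
  define A where "A = {\<theta> \<in> space \<pi>. K \<theta> \<le> real N}"
  have A [measurable]: "A \<in> sets \<pi>" unfolding A_def by measurable
  have A_int: "integrable \<pi> (indicator A :: 'a \<Rightarrow> real)"
    by (rule integrable_real_indicator) (auto simp: less_top[symmetric])
  define p where "p = prob A"
  have p: "0 < p" using N by (simp add: p_def A_def)
  \<comment> \<open>The global lower bound of the conjugate, used off \<open>A\<close>.\<close>
  define c where "c = - \<phi> 0"
  have lower: "l + ((- (2 / p) * real N - \<phi> (2 / p) - c) * p + c) \<le> dual l" for l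
  proof -
    \<comment> \<open>\<open>?v\<close> is the excess over \<open>c\<close> of the Fenchel bound on
      \<open>A\<close>. After integration it contributes \<open>2 * l\<close>, and the term
      \<open>- l\<close> of the dual leaves slope 1.\<close>
    let ?v = "(2 / p) * (l - real N) - \<phi> (2 / p) - c"
    have "v * p + c = (\<integral>\<theta>. v * indicator A \<theta> + c \<partial>\<pi>)" for v
      using A_int by (simp add: p_def prob_space)
    then have "?v * p + c = (\<integral>\<theta>. ?v * indicator A \<theta> + c \<partial>\<pi>)" .
    also have "\<dots> \<le> (\<integral>\<theta>. phi_conj \<phi> (l - K \<theta>) \<partial>\<pi>)"
    proof (rule integral_mono)
      show "integrable \<pi> (\<lambda>\<theta>. ?v * indicator A \<theta> + c)" using A_int by simp
      fix \<theta>
      assume "\<theta> \<in> space \<pi>"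
      show "?v * indicator A \<theta> + c \<le> phi_conj \<phi> (l - K \<theta>)"
      proof (cases "\<theta> \<in> A")
        case True
        then have "phi_conj \<phi> (l - real N) \<le> phi_conj \<phi> (l - K \<theta>)"
          by (intro monoD[OF mono_conj]) (auto simp: A_def)
        with True fenchel[of "2 / p" "l - real N"] p show ?thesis by simp
      next
        case False
        then show ?thesis using conj_lower_bound[of "l - K \<theta>"] by (simp add: c_def)
      qed
    qed (rule integrable_conj)
    finally show ?thesis using p by (simp add: dual_def field_simps)
  qed
  show ?thesis
    by (rule filterlim_at_top_mono[OF filterlim_tendsto_add_at_top[OF tendsto_const filterlim_ident]])
      (use lower in \<open>auto simp: add.commute intro!: always_eventually\<close>)
qed

text \<open>The integral is at least \<open>- \<phi> 0\<close>, so the term \<open>- l\<close>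
  dominates.\<close>

lemma dual_at_bot: "filterlim dual at_top at_bot"
proof -
  have "- \<phi> 0 + (- l) \<le> dual l" for l
  proof -
    have "(\<integral>\<theta>. - \<phi> 0 \<partial>\<pi>) \<le> (\<integral>\<theta>. phi_conj \<phi> (l - K \<theta>) \<partial>\<pi>)"
      by (intro integral_mono integrable_conj conj_lower_bound) simp
    then show ?thesis by (simp add: dual_def prob_space)
  qed
  then show ?thesis
    by (intro filterlim_at_top_mono[OF filterlim_tendsto_add_at_top[OF tendsto_const filterlim_uminus_at_top_at_bot]])
      (auto intro!: always_eventually)
qed

lemma is_arg_min_dual_normalized:
  assumes "is_arg_min dual (\<lambda>_. True) l"
  shows "(\<integral>\<theta>. maximizer (l - K \<theta>) \<partial>\<pi>) = 1"
proof -
  have "ddual l = 0"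
    by (rule DERIV_local_min[OF DERIV_dual zero_less_one]) (use assms in \<open>auto simp: is_arg_min_def not_less\<close>)
  then show ?thesis by (simp add: ddual_def)
qed

text \<open>The mass of the density \<open>maximizer (l - K \<theta>)\<close> increases strictly with \<open>l\<close> as long as it is
  positive, so it equals \<open>1\<close> for one \<open>l\<close> only.\<close>

lemma dual_unique_argmin: "\<exists>!l. is_arg_min dual (\<lambda>_. True) l"
proof (rule ex_ex1I)
  have "continuous_on UNIV dual"
    by (intro continuous_at_imp_continuous_on ballI DERIV_isCont[OF DERIV_dual])
  then show "\<exists>l. is_arg_min dual (\<lambda>_. True) l"
    using continuous_coercive_attains_inf[OF _ dual_at_top dual_at_bot]
    by (auto simp: is_arg_min_def not_less)
next
  have neq: False if l: "(\<integral>\<theta>. maximizer (l - K \<theta>) \<partial>\<pi>) = 1" and l': "(\<integral>\<theta>. maximizer (l' - K \<theta>) \<partial>\<pi>) = 1"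
    and "l < l'" for l l'
  proof -
    let ?d = "\<lambda>\<theta>. maximizer (l' - K \<theta>) - maximizer (l - K \<theta>)"
    have int: "integrable \<pi> ?d" using integrable_maximizer by simp
    have nn: "AE \<theta> in \<pi>. 0 \<le> ?d \<theta>"
      using \<open>l < l'\<close> by (auto intro!: AE_I2 monoD[OF mono_maximizer])
    have "(\<integral>\<theta>. ?d \<theta> \<partial>\<pi>) = 0" using integrable_maximizer l l' by simp
    then have "AE \<theta> in \<pi>. ?d \<theta> = 0" using integral_nonneg_eq_0_iff_AE[OF int nn] by simp
    \<comment> \<open>Where the density for \<open>l\<close> is positive, the one for
      \<open>l'\<close> is strictly larger; almost everywhere equality leaves only the value 0,
      against mass 1.\<close>
    then have "AE \<theta> in \<pi>. maximizer (l - K \<theta>) = 0"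
    proof eventually_elim
      case (elim \<theta>)
      show ?case
      proof (rule ccontr)
        assume "maximizer (l - K \<theta>) \<noteq> 0"
        then have "0 < maximizer (l - K \<theta>)" using maximizer_nonneg by (metis order_le_less)
        from maximizer_strict_mono[OF _ this, of "l' - K \<theta>"] \<open>l < l'\<close> elim show False by simp
      qed
    qed
    then have "(\<integral>\<theta>. maximizer (l - K \<theta>) \<partial>\<pi>) = 0" by (rule integral_eq_zero_AE)
    with l show False by simp
  qed
  fix l l'
  assume "is_arg_min dual (\<lambda>_. True) l" "is_arg_min dual (\<lambda>_. True) l'"
  then show "l = l'"
    using neq[of l l'] neq[of l' l] is_arg_min_dual_normalized by (cases l l' rule: linorder_cases) auto
qed

section \<open>The primal problem\<close>

text \<open>This is \<open>\<eta>\<close> times the stated objective once \<open>K\<close> is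
  \<open>\<eta>\<close> times the cumulative loss. As \<open>K\<close> is nonnegative, its
  expectation is a nonnegative integral, possibly infinite.\<close>

definition primal :: "'a measure \<Rightarrow> ereal" where
  "primal \<rho> = enn2ereal (\<integral>\<^sup>+ \<theta>. ennreal (K \<theta>) \<partial>\<rho>) + phi_divergence \<phi> \<rho> \<pi>"

text \<open>Holds for every \<open>l\<close>. If \<open>\<rho>\<close> has no density or one of the
  two costs is infinite, the right side is \<open>\<infinity>\<close>; otherwise Fenchel's
  inequality is integrated at \<open>x = r \<theta>\<close>, \<open>y = l - K \<theta>\<close>,
  where unit mass of \<open>r\<close> turns \<open>r \<theta> * l\<close> into
  \<open>l\<close>.\<close>

lemma weak_duality:
  assumes "prob_space \<rho>" and sets: "sets \<rho> = sets \<pi>"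
  shows "ereal (- dual l) \<le> primal \<rho>"
proof (cases "absolutely_continuous \<pi> \<rho>")
  case False
  then have "primal \<rho> = \<infinity>"
    by (simp add: primal_def phi_divergence_def)
  then show ?thesis by simp
next
  case True
  interpret R: prob_space \<rho> by fact
  define r where "r = (\<lambda>\<theta>. enn2real (RN_deriv \<pi> \<rho> \<theta>))"
  have r_meas [measurable]: "r \<in> borel_measurable \<pi>" by (simp add: r_def)
  have r_nn: "0 \<le> r \<theta>" for \<theta> by (simp add: r_def)
  \<comment> \<open>The derivative is finite almost everywhere, so passing to the real-valued
    \<open>r\<close> does not change the density.\<close>
  have "AE \<theta> in \<pi>. RN_deriv \<pi> \<rho> \<theta> \<noteq> \<infinity>"
    by (rule RN_deriv_finite[OF R.sigma_finite_measure_axioms True sets])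
  then have r_eq: "AE \<theta> in \<pi>. RN_deriv \<pi> \<rho> \<theta> = ennreal (r \<theta>)"
    by eventually_elim (simp add: r_def less_top)
  have \<rho>: "\<rho> = density \<pi> (\<lambda>\<theta>. ennreal (r \<theta>))"
    using density_RN_deriv[OF True sets] density_cong[OF _ _ r_eq] by simp
  have mass: "(\<integral>\<^sup>+ \<theta>. ennreal (r \<theta>) \<partial>\<pi>) = 1"
  proof -
    have "emeasure \<rho> (space \<pi>) = 1"
      using R.emeasure_space_1 sets_eq_imp_space_eq[OF sets] by simp
    also have "emeasure \<rho> (space \<pi>) = (\<integral>\<^sup>+ \<theta>. ennreal (r \<theta>) \<partial>\<pi>)"
      by (subst \<rho>) (simp add: emeasure_density cong: nn_integral_cong)
    finally show ?thesis by simp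
  qed
  have r_int: "integrable \<pi> r" and r_1: "(\<integral>\<theta>. r \<theta> \<partial>\<pi>) = 1"
    using mass r_nn by (auto intro!: integrableI_nonneg simp: integral_eq_nn_integral)
  have K_nn: "(\<integral>\<^sup>+ \<theta>. ennreal (K \<theta>) \<partial>\<rho>) = (\<integral>\<^sup>+ \<theta>. ennreal (r \<theta> * K \<theta>) \<partial>\<pi>)"
    by (subst \<rho>) (simp add: nn_integral_density ennreal_mult' r_nn)
  have phi_meas [measurable]: "(\<lambda>\<theta>. \<phi> (r \<theta>)) \<in> borel_measurable \<pi>"
    by (rule borel_measurable_phi_comp[OF r_meas r_nn])
  have D: "phi_divergence \<phi> \<rho> \<pi> = (if integrable \<pi> (\<lambda>\<theta>. \<phi> (r \<theta>)) then ereal (\<integral>\<theta>. \<phi> (r \<theta>) \<partial>\<pi>) else \<infinity>)"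
    using True ext_expectation_bounded_below[OF phi_meas phi_lower_bound[OF r_nn]]
    by (simp add: phi_divergence_def r_def)
  show ?thesis
  proof (cases "integrable \<pi> (\<lambda>\<theta>. \<phi> (r \<theta>)) \<and> (\<integral>\<^sup>+ \<theta>. ennreal (r \<theta> * K \<theta>) \<partial>\<pi>) \<noteq> \<infinity>")
    case False
    then have "primal \<rho> = \<infinity>" by (auto simp: primal_def D K_nn)
    then show ?thesis by simp
  next
    case fin: True
    have rK_nn: "AE \<theta> in \<pi>. 0 \<le> r \<theta> * K \<theta>" using r_nn K_nonneg by (auto intro!: AE_I2)
    have rK: "integrable \<pi> (\<lambda>\<theta>. r \<theta> * K \<theta>)"
      using fin rK_nn by (auto intro!: integrableI_nonneg simp: less_top)
    have "- dual l = (\<integral>\<theta>. r \<theta> * l - phi_conj \<phi> (l - K \<theta>) \<partial>\<pi>)"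
      using r_int r_1 integrable_conj by (simp add: dual_def)
    also have "\<dots> \<le> (\<integral>\<theta>. r \<theta> * K \<theta> + \<phi> (r \<theta>) \<partial>\<pi>)"
    proof (rule integral_mono)
      fix \<theta>
      show "r \<theta> * l - phi_conj \<phi> (l - K \<theta>) \<le> r \<theta> * K \<theta> + \<phi> (r \<theta>)"
        using fenchel[OF r_nn, of \<theta> "l - K \<theta>"] by (simp add: algebra_simps)
    qed (use r_int integrable_conj rK fin in auto)
    also have "\<dots> = (\<integral>\<theta>. r \<theta> * K \<theta> \<partial>\<pi>) + (\<integral>\<theta>. \<phi> (r \<theta>) \<partial>\<pi>)"
      using rK fin by simp
    finally have le: "- dual l \<le> (\<integral>\<theta>. r \<theta> * K \<theta> \<partial>\<pi>) + (\<integral>\<theta>. \<phi> (r \<theta>) \<partial>\<pi>)" .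
    have "(\<integral>\<^sup>+ \<theta>. ennreal (r \<theta> * K \<theta>) \<partial>\<pi>) = ennreal (\<integral>\<theta>. r \<theta> * K \<theta> \<partial>\<pi>)"
      by (rule nn_integral_eq_integral[OF rK rK_nn])
    then have "primal \<rho> = ereal ((\<integral>\<theta>. r \<theta> * K \<theta> \<partial>\<pi>) + (\<integral>\<theta>. \<phi> (r \<theta>) \<partial>\<pi>))"
      using fin integral_nonneg_AE[OF rK_nn] by (simp add: primal_def D K_nn enn2ereal_ennreal)
    with le show ?thesis by simp
  qed
qed

text \<open>For \<open>\<phi> x = x * ln x\<close> one has \<open>maximizer y = exp (y - 1)\<close>,
  and the normalized measure is the classical Gibbs measure with energy \<open>K\<close>.\<close>

definition gibbs :: "real \<Rightarrow> 'a measure" where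
  "gibbs l = density \<pi> (\<lambda>\<theta>. ennreal (maximizer (l - K \<theta>)))"

lemma sets_gibbs: "sets (gibbs l) = sets \<pi>"
  by (simp add: gibbs_def)

lemma prob_space_gibbs:
  assumes "(\<integral>\<theta>. maximizer (l - K \<theta>) \<partial>\<pi>) = 1"
  shows "prob_space (gibbs l)"
proof (rule prob_spaceI)
  have "emeasure (gibbs l) (space (gibbs l)) = (\<integral>\<^sup>+ \<theta>. ennreal (maximizer (l - K \<theta>)) \<partial>\<pi>)"
    by (simp add: gibbs_def emeasure_density cong: nn_integral_cong)
  also have "\<dots> = ennreal (\<integral>\<theta>. maximizer (l - K \<theta>) \<partial>\<pi>)"
    by (rule nn_integral_eq_integral[OF integrable_maximizer]) simp
  finally show "emeasure (gibbs l) (space (gibbs l)) = 1" by (simp add: assms)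
qed

text \<open>For this density Fenchel's inequality is an equality at every point, so integration
  loses nothing.\<close>

lemma strong_duality:
  assumes one: "(\<integral>\<theta>. maximizer (l - K \<theta>) \<partial>\<pi>) = 1"
  shows "primal (gibbs l) = ereal (- dual l)"
proof -
  define r where "r = (\<lambda>\<theta>. maximizer (l - K \<theta>))"
  have r_meas [measurable]: "r \<in> borel_measurable \<pi>" by (simp add: r_def)
  have r_nn: "0 \<le> r \<theta>" for \<theta> by (simp add: r_def)
  have r_int: "integrable \<pi> r" using integrable_maximizer by (simp add: r_def)
  have g: "gibbs l = density \<pi> (\<lambda>\<theta>. ennreal (r \<theta>))" by (simp add: gibbs_def r_def)
  have ac: "absolutely_continuous \<pi> (gibbs l)"
    unfolding g by (rule absolutely_continuousI_density) measurable
  have "AE \<theta> in \<pi>. ennreal (r \<theta>) = RN_deriv \<pi> (gibbs l) \<theta>"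
    by (rule RN_deriv_unique) (auto simp: g)
  then have RN: "AE \<theta> in \<pi>. enn2real (RN_deriv \<pi> (gibbs l) \<theta>) = r \<theta>"
    by eventually_elim (metis enn2real_ennreal r_nn)
  have phi_meas [measurable]: "(\<lambda>\<theta>. \<phi> (r \<theta>)) \<in> borel_measurable \<pi>"
    by (rule borel_measurable_phi_comp[OF r_meas r_nn])
  \<comment> \<open>The density takes values in the compact interval
    \<open>{0..maximizer l}\<close>, on which \<open>\<phi>\<close> is bounded.\<close>
  have phi_int: "integrable \<pi> (\<lambda>\<theta>. \<phi> (r \<theta>))"
  proof -
    have "compact (\<phi> ` {0..maximizer l})"
      by (intro compact_continuous_image continuous_on_subset[OF cont]) auto
    then obtain B where B: "\<And>x. x \<in> {0..maximizer l} \<Longrightarrow> \<bar>\<phi> x\<bar> \<le> B"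
      using compact_imp_bounded bounded_iff by (metis image_eqI real_norm_def)
    then show ?thesis
      using maximizer_le[of _ l]
      by (intro integrable_const_bound[OF _ phi_meas, where B = B]) (auto intro!: AE_I2 simp: r_def)
  qed
  have phi_RN_meas: "(\<lambda>\<theta>. \<phi> (enn2real (RN_deriv \<pi> (gibbs l) \<theta>))) \<in> borel_measurable \<pi>"
    by (rule borel_measurable_phi_comp) auto
  have phi_eq: "AE \<theta> in \<pi>. \<phi> (enn2real (RN_deriv \<pi> (gibbs l) \<theta>)) = \<phi> (r \<theta>)"
    using RN by eventually_elim simp
  have "integrable \<pi> (\<lambda>\<theta>. \<phi> (enn2real (RN_deriv \<pi> (gibbs l) \<theta>)))"
    and "(\<integral>\<theta>. \<phi> (enn2real (RN_deriv \<pi> (gibbs l) \<theta>)) \<partial>\<pi>) = (\<integral>\<theta>. \<phi> (r \<theta>) \<partial>\<pi>)"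
    using phi_int integrable_cong_AE[OF phi_RN_meas phi_meas phi_eq]
      integral_cong_AE[OF phi_RN_meas phi_meas phi_eq] by simp_all
  then have D: "phi_divergence \<phi> (gibbs l) \<pi> = ereal (\<integral>\<theta>. \<phi> (r \<theta>) \<partial>\<pi>)"
    using ac ext_expectation_bounded_below[OF phi_RN_meas phi_lower_bound]
    by (simp add: phi_divergence_def)
  \<comment> \<open>The equality case solved for \<open>r \<theta> * K \<theta>\<close>: it yields
    integrability even if \<open>K\<close> is unbounded, and then the value of the integral.\<close>
  have rK_eq: "r \<theta> * K \<theta> = r \<theta> * l - phi_conj \<phi> (l - K \<theta>) - \<phi> (r \<theta>)" for \<theta>
    using maximizer_attains[of "l - K \<theta>"] by (simp add: r_def algebra_simps)
  have rK: "integrable \<pi> (\<lambda>\<theta>. r \<theta> * K \<theta>)"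
    unfolding rK_eq using r_int phi_int integrable_conj by simp
  have rK_nn: "AE \<theta> in \<pi>. 0 \<le> r \<theta> * K \<theta>" using r_nn K_nonneg by (auto intro!: AE_I2)
  have "(\<integral>\<^sup>+ \<theta>. ennreal (K \<theta>) \<partial>gibbs l) = (\<integral>\<^sup>+ \<theta>. ennreal (r \<theta> * K \<theta>) \<partial>\<pi>)"
    by (simp add: g nn_integral_density ennreal_mult' r_nn)
  also have "\<dots> = ennreal (\<integral>\<theta>. r \<theta> * K \<theta> \<partial>\<pi>)"
    by (rule nn_integral_eq_integral[OF rK rK_nn])
  finally have "primal (gibbs l) = ereal ((\<integral>\<theta>. r \<theta> * K \<theta> \<partial>\<pi>) + (\<integral>\<theta>. \<phi> (r \<theta>) \<partial>\<pi>))"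
    using integral_nonneg_AE[OF rK_nn] by (simp add: primal_def D enn2ereal_ennreal)
  moreover have "(\<integral>\<theta>. r \<theta> * K \<theta> \<partial>\<pi>) = - dual l - (\<integral>\<theta>. \<phi> (r \<theta>) \<partial>\<pi>)"
    unfolding rK_eq using r_int phi_int integrable_conj one by (simp add: dual_def r_def)
  ultimately show ?thesis by simp
qed

end

text \<open>Integrability belongs to the conclusion because a Bochner integral defaults to 0
  otherwise. The equivalence for \<open>is_arg_max\<close> encodes existence and uniqueness of the
  maximizer, and for \<open>t = 1\<close> the loss sum is empty.\<close>

theorem proposition3p1:
  fixes M :: "'a measure"
    and \<pi> :: "'a measure"
    and \<eta> :: real
    and loss :: "nat \<Rightarrow> 'a \<Rightarrow> real"
    and \<phi> :: "real \<Rightarrow> real"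
  assumes "\<pi> \<in> space (prob_algebra M)"
    and "\<eta> > 0"
    and "\<And>s. loss s \<in> borel_measurable M"
    and "\<And>s \<theta>. \<theta> \<in> space M \<Longrightarrow> 0 \<le> loss s \<theta>"
    and "\<phi> 1 = 0"
    and "bdd_below (\<phi> ` {0..})"
    and "continuous_on {0..} \<phi>"
    and "\<And>x. x > 0 \<Longrightarrow> \<phi> differentiable (at x)"
    and "strictly_convex_on {0..} \<phi>"
    and "\<And>y. convex_conjugate (extend_phi \<phi>) y < \<infinity>"
  shows "(\<forall>y. convex_conjugate (extend_phi \<phi>) y = (SUP x\<in>{0..}. ereal (x * y - \<phi> x))) \<and>
    (\<forall>y. phi_conj \<phi> differentiable (at y) \<and>
         (\<forall>z. is_arg_max (\<lambda>x. x * y - \<phi> x) (\<lambda>x. 0 \<le> x) z \<longleftrightarrow> z = deriv (phi_conj \<phi>) y)) \<and>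
    ((\<forall>a\<ge>0. ((\<lambda>l. convex_conjugate (extend_phi \<phi>) (l - a) - ereal l) \<longlongrightarrow> \<infinity>) at_top) \<longrightarrow>
      (\<forall>t\<ge>1.
        let L = (\<lambda>\<theta>. \<Sum>s\<in>{1..<t}. loss s \<theta>);
            F = (\<lambda>l. (\<integral>\<theta>. phi_conj \<phi> (l - \<eta> * L \<theta>) \<partial>\<pi>) - l)
        in (\<forall>l. integrable \<pi> (\<lambda>\<theta>. phi_conj \<phi> (l - \<eta> * L \<theta>))) \<and>
           (\<exists>!l. is_arg_min F (\<lambda>_. True) l) \<and>
           (\<forall>l. is_arg_min F (\<lambda>_. True) l \<longrightarrow>
              is_arg_min
                (\<lambda>\<rho>. (\<Sum>s\<in>{1..<t}. ext_expectation \<rho> (loss s)) + phi_divergence \<phi> \<rho> \<pi> / ereal \<eta>)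
                (\<lambda>\<rho>. \<rho> \<in> space (prob_algebra M))
                (density \<pi> (\<lambda>\<theta>. ennreal (deriv (phi_conj \<phi>) (l - \<eta> * L \<theta>)))))))"
proof -
  interpret divergence_function \<phi>
    by unfold_locales (use assms in auto)
  have \<pi>: "prob_space \<pi>" "sets \<pi> = sets M"
    using assms(1) by (auto simp: space_prob_algebra)
  have space: "space \<pi> = space M" by (rule sets_eq_imp_space_eq[OF \<pi>(2)])
  have part2: "phi_conj \<phi> differentiable (at y) \<and>
      (\<forall>z. is_arg_max (\<lambda>x. x * y - \<phi> x) (\<lambda>x. 0 \<le> x) z \<longleftrightarrow> z = deriv (phi_conj \<phi>) y)" for y
    using DERIV_conj[of y] is_arg_max_iff_maximizer by (auto simp: deriv_conj real_differentiable_def)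
  have part3: "let L = (\<lambda>\<theta>. \<Sum>s\<in>{1..<t}. loss s \<theta>);
            F = (\<lambda>l. (\<integral>\<theta>. phi_conj \<phi> (l - \<eta> * L \<theta>) \<partial>\<pi>) - l)
        in (\<forall>l. integrable \<pi> (\<lambda>\<theta>. phi_conj \<phi> (l - \<eta> * L \<theta>))) \<and>
           (\<exists>!l. is_arg_min F (\<lambda>_. True) l) \<and>
           (\<forall>l. is_arg_min F (\<lambda>_. True) l \<longrightarrow>
              is_arg_min
                (\<lambda>\<rho>. (\<Sum>s\<in>{1..<t}. ext_expectation \<rho> (loss s)) + phi_divergence \<phi> \<rho> \<pi> / ereal \<eta>)
                (\<lambda>\<rho>. \<rho> \<in> space (prob_algebra M))
                (density \<pi> (\<lambda>\<theta>. ennreal (deriv (phi_conj \<phi>) (l - \<eta> * L \<theta>)))))" for t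
  proof -
    define L where "L = (\<lambda>\<theta>. \<Sum>s\<in>{1..<t}. loss s \<theta>)"
    have loss_meas [measurable]: "loss s \<in> borel_measurable \<rho>" if "sets \<rho> = sets M" for s \<rho>
      using assms(3)[of s] that by (simp cong: measurable_cong_sets)
    interpret divergence_penalty \<phi> \<pi> "\<lambda>\<theta>. \<eta> * L \<theta>"
    proof (intro divergence_penalty.intro divergence_function_axioms \<pi> divergence_penalty_axioms.intro)
      show "(\<lambda>\<theta>. \<eta> * L \<theta>) \<in> borel_measurable \<pi>"
        unfolding L_def using loss_meas[OF \<pi>(2)] by measurable
      show "0 \<le> \<eta> * L \<theta>" if "\<theta> \<in> space \<pi>" for \<theta>
        using that assms(2,4) by (auto simp: L_def space intro!: mult_nonneg_nonneg sum_nonneg)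
    qed
    let ?J = "\<lambda>\<rho>. (\<Sum>s\<in>{1..<t}. ext_expectation \<rho> (loss s)) + phi_divergence \<phi> \<rho> \<pi> / ereal \<eta>"
    \<comment> \<open>Nonnegative losses have zero negative part, so the sum of expectations is one
      nonnegative integral, from which \<open>\<eta>\<close> can be pulled out.\<close>
    have J: "?J \<rho> = primal \<rho> / ereal \<eta>" if \<rho>: "\<rho> \<in> space (prob_algebra M)" for \<rho>
    proof -
      have sets: "sets \<rho> = sets M" using \<rho> by (simp add: space_prob_algebra)
      have sp: "space \<rho> = space M" by (rule sets_eq_imp_space_eq[OF sets])
      have "ext_expectation \<rho> (loss s) = enn2ereal (\<integral>\<^sup>+ \<theta>. ennreal (loss s \<theta>) \<partial>\<rho>)" for s
      proof -
        have "(\<integral>\<^sup>+ \<theta>. ennreal (- loss s \<theta>) \<partial>\<rho>) = (\<integral>\<^sup>+ \<theta>. 0 \<partial>\<rho>)"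
          using assms(4) sp by (intro nn_integral_cong) (simp add: ennreal_neg)
        then show ?thesis by (simp add: ext_expectation_def zero_ennreal.rep_eq)
      qed
      then have "(\<Sum>s\<in>{1..<t}. ext_expectation \<rho> (loss s))
          = enn2ereal (\<Sum>s\<in>{1..<t}. \<integral>\<^sup>+ \<theta>. ennreal (loss s \<theta>) \<partial>\<rho>)"
        by simp
      also have "(\<Sum>s\<in>{1..<t}. \<integral>\<^sup>+ \<theta>. ennreal (loss s \<theta>) \<partial>\<rho>)
          = (\<integral>\<^sup>+ \<theta>. (\<Sum>s\<in>{1..<t}. ennreal (loss s \<theta>)) \<partial>\<rho>)"
        using loss_meas[OF sets] by (intro nn_integral_sum[symmetric]) simp
      also have "\<dots> = (\<integral>\<^sup>+ \<theta>. ennreal (L \<theta>) \<partial>\<rho>)"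
        using assms(4) sp by (intro nn_integral_cong) (simp add: L_def)
      finally have sum: "(\<Sum>s\<in>{1..<t}. ext_expectation \<rho> (loss s)) = enn2ereal (\<integral>\<^sup>+ \<theta>. ennreal (L \<theta>) \<partial>\<rho>)" .
      have L_meas: "L \<in> borel_measurable \<rho>"
        unfolding L_def using loss_meas[OF sets] by measurable
      have "(\<integral>\<^sup>+ \<theta>. ennreal (\<eta> * L \<theta>) \<partial>\<rho>) = ennreal \<eta> * (\<integral>\<^sup>+ \<theta>. ennreal (L \<theta>) \<partial>\<rho>)"
        using assms(2) L_meas by (simp add: ennreal_mult' nn_integral_cmult)
      then have "primal \<rho> = ereal \<eta> * enn2ereal (\<integral>\<^sup>+ \<theta>. ennreal (L \<theta>) \<partial>\<rho>) + phi_divergence \<phi> \<rho> \<pi>"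
        using assms(2) by (simp add: primal_def times_ennreal.rep_eq enn2ereal_ennreal)
      then show ?thesis
        unfolding sum using assms(2)
        by (cases "enn2ereal (\<integral>\<^sup>+ \<theta>. ennreal (L \<theta>) \<partial>\<rho>)"; cases "phi_divergence \<phi> \<rho> \<pi>")
          (auto simp: field_simps)
    qed
    have "is_arg_min ?J (\<lambda>\<rho>. \<rho> \<in> space (prob_algebra M)) (gibbs l)"
      if l: "is_arg_min dual (\<lambda>_. True) l" for l
    proof -
      note one = is_arg_min_dual_normalized[OF l]
      have mem: "gibbs l \<in> space (prob_algebra M)"
        using prob_space_gibbs[OF one] sets_gibbs[of l] \<pi>(2) by (simp add: space_prob_algebra)
      \<comment> \<open>Both sides are compared with \<open>- dual l\<close> for the same
        \<open>l\<close>: equality on the left, weak duality on the right. Division by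
        \<open>\<eta> > 0\<close> keeps the order.\<close>
      have "?J (gibbs l) \<le> ?J \<rho>" if \<rho>: "\<rho> \<in> space (prob_algebra M)" for \<rho>
        unfolding J[OF mem] J[OF \<rho>] strong_duality[OF one]
        using \<rho> \<pi>(2) assms(2)
        by (intro ereal_divide_right_mono weak_duality) (auto simp: space_prob_algebra)
      with mem show ?thesis by (auto simp: is_arg_min_def not_less)
    qed
    note argmin = this
    have dual_eq: "dual = (\<lambda>l. (\<integral>\<theta>. phi_conj \<phi> (l - \<eta> * L \<theta>) \<partial>\<pi>) - l)"
      by (simp add: dual_def fun_eq_iff)
    have L_eq: "L \<theta> = (\<Sum>s\<in>{1..<t}. loss s \<theta>)" for \<theta> by (simp add: L_def)
    show ?thesis
      unfolding Let_def deriv_conj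
      using integrable_conj[unfolded L_eq] dual_unique_argmin[unfolded dual_eq, unfolded L_eq]
        argmin[unfolded dual_eq gibbs_def, unfolded L_eq] by blast
  qed
  show ?thesis
    using part2 part3 convex_conjugate_extend_phi by blast
qed

end
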